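(* Let $\Delta$ be a finite, connected and nontrivial multidigraph with vertex set $V_\Delta$. Then $\Delta$ is circuit-Eulerian if and only if $\Delta$ is strongly connected and $\tau_\Delta(x)=\eta_\Delta(x)$ for every $x\in V_\Delta$.
   Context: A multidigraph (directed multigraph) $\Delta$ consists of a nonempty set $V_\Delta$ of vertices and a family of directed edges (diedges), each having a tailpoint $x\in V_\Delta$ and a headpoint $y\in V_\Delta$, written $x\rightarrow y$. Several distinct diedges may have the same tailpoint and headpoint, and loops $x\rightarrow x$ are allowed. $\Delta$ is finite if it has finitely many vertices and diedges, connected if its underlying undirected multigraph is connected, and nontrivial if it has at least one diedge. The out-degree $\tau_\Delta(x)$ is the number of diedges of $\Delta$ with tailpoint $x$, and the in-degree $\eta_\Delta(x)$ is the number of diedges of $\Delta$ with headpoint $x$ (so a loop at $x$ contributes one to each). A dipath is a directed walk $x_0\rightarrow x_1\rightarrow\cdots\rightarrow x_n$ formed by successive diedges of $\Delta$ (vertices and diedges may be repeated). A dicircuit is such a directed walk with $n\ge 1$ and $x_n=x_0$. An Eulerian dicircuit of $\Delta$ is a dicircuit in which each diedge of $\Delta$ occurs exactly once. $\Delta$ is circuit-Eulerian if it has an Eulerian dicircuit. $\Delta$ is strongly connected if every two distinct vertices of $\Delta$ occur in a common dicircuit of $\Delta$. *)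

theory Defs
  imports "Graph_Theory.Euler"
begin

context pre_digraph
begin

text \<open>
  A walk is the list of its arcs, so a dicircuit may repeat vertices and arcs; the library's
  \<open>cycle\<close> would forbid repeated vertices.
\<close>
definition dicircuit :: "'a \<Rightarrow> 'b awalk \<Rightarrow> bool" where
  "dicircuit u p \<longleftrightarrow> awalk u p u \<and> length p \<ge> 1"

definition eulerian_dicircuit :: "'a \<Rightarrow> 'b awalk \<Rightarrow> bool" where
  "eulerian_dicircuit u p \<longleftrightarrow> dicircuit u p \<and> (\<forall>e \<in> arcs G. count_list p e = 1)"

definition circuit_eulerian :: bool where
  "circuit_eulerian \<longleftrightarrow> (\<exists>u p. eulerian_dicircuit u p)"

text \<open>
  Unlike the library's \<open>strongly_connected\<close>, which is defined by mutual reachability, this notion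
  asks for a common dicircuit of any two distinct vertices.
\<close>
definition dicircuit_strongly_connected :: bool where
  "dicircuit_strongly_connected \<longleftrightarrow>
    (\<forall>x \<in> verts G. \<forall>y \<in> verts G. x \<noteq> y \<longrightarrow>
      (\<exists>u p. dicircuit u p \<and> x \<in> set (awalk_verts u p) \<and> y \<in> set (awalk_verts u p)))"

end

end

theory Submission
  imports Defs
begin

text \<open>
  The underlying fact is Euler's theorem in the form \<open>closed_euler\<close>: a finite digraph has a closed
  Euler trail iff it is connected and balanced, that is, in-degree and out-degree agree at every
  vertex. A closed walk enters each vertex as often as it leaves it, so using each arc once forces
  balance. Conversely, in a balanced digraph a trail that is not closed can be extended at its
  start, and a closed trail that misses an arc can be rotated, by connectedness, so that a missing
  arc touching it extends it; a trail of maximal length is therefore a closed Euler trail.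

  Two bridges connect this to dicircuits. In a connected digraph with at least one arc, the Eulerian
  dicircuits are exactly the closed Euler trails: no vertex is isolated, so a walk through all arcs
  meets all vertices (\<open>eulerian_dicircuit_iff_euler_trail\<close>). And since an Eulerian dicircuit meets
  all vertices, it is itself a common dicircuit for any two of them
  (\<open>eulerian_dicircuit_imp_dicircuit_strongly_connected\<close>).
\<close>

lemma distinct_iff_count_list_eq_1: "distinct xs \<longleftrightarrow> (\<forall>x \<in> set xs. count_list xs x = 1)"
  by (induction xs) (auto simp: count_list_0_iff)

context wf_digraph
begin

text \<open>
  A walk has all its arcs in the digraph, so multiplicity one for each arc of the digraph leaves no
  room for repetitions; this is why counting arcs amounts to being a trail that covers the arc set.
\<close>
lemma eulerian_dicircuit_iff_trail:
  "eulerian_dicircuit u p \<longleftrightarrow> trail u p u \<and> set p = arcs G \<and> p \<noteq> []"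
proof
  assume "eulerian_dicircuit u p"
  then have walk: "awalk u p u" and ne: "p \<noteq> []"
    and once: "\<forall>e \<in> arcs G. count_list p e = 1"
    by (auto simp: eulerian_dicircuit_def dicircuit_def)
  have arcs: "set p = arcs G"
  proof
    show "set p \<subseteq> arcs G" using walk by auto
    show "arcs G \<subseteq> set p"
    proof
      fix e assume "e \<in> arcs G"
      with once have "count_list p e \<noteq> 0" by simp
      then show "e \<in> set p" by (simp add: count_list_0_iff)
    qed
  qed
  then have "distinct p" using once by (simp add: distinct_iff_count_list_eq_1)
  with walk ne arcs show "trail u p u \<and> set p = arcs G \<and> p \<noteq> []"
    by (simp add: trail_def)
next
  assume "trail u p u \<and> set p = arcs G \<and> p \<noteq> []"
  then show "eulerian_dicircuit u p"
    by (auto simp: eulerian_dicircuit_def dicircuit_def trail_def Suc_le_eq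
        distinct_iff_count_list_eq_1)
qed

lemma eulerian_dicircuit_iff_euler_trail:
  assumes "connected G" "arcs G \<noteq> {}"
  shows "eulerian_dicircuit u p \<longleftrightarrow> euler_trail u p u"
  using assms by (auto simp: eulerian_dicircuit_iff_trail euler_trail_conv_connected)

lemma eulerian_dicircuit_imp_dicircuit_strongly_connected:
  assumes "connected G" "eulerian_dicircuit u p"
  shows dicircuit_strongly_connected
proof -
  from assms(2) have "arcs G \<noteq> {}" by (auto simp: eulerian_dicircuit_iff_trail)
  with assms have "euler_trail u p u" by (simp add: eulerian_dicircuit_iff_euler_trail)
  then have "set (awalk_verts u p) = verts G" by (simp add: euler_trail_def)
  moreover have "dicircuit u p" using assms(2) by (simp add: eulerian_dicircuit_def)
  ultimately show ?thesis unfolding dicircuit_strongly_connected_def by blast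
qed

end

theorem theorem5:
  fixes \<Delta> :: "('a, 'b) pre_digraph"
  assumes "fin_digraph \<Delta>"
    and "verts \<Delta> \<noteq> {}"
    and "connected \<Delta>"
    and "arcs \<Delta> \<noteq> {}"
  shows "pre_digraph.circuit_eulerian \<Delta> \<longleftrightarrow>
    pre_digraph.dicircuit_strongly_connected \<Delta> \<and>
    (\<forall>x \<in> verts \<Delta>. out_degree \<Delta> x = in_degree \<Delta> x)"
proof -
  interpret fin_digraph \<Delta> by (fact assms(1))
  have "circuit_eulerian \<longleftrightarrow> (\<exists>u p. euler_trail u p u)"
    using assms(3,4) by (simp add: circuit_eulerian_def eulerian_dicircuit_iff_euler_trail)
  then have euler: "circuit_eulerian \<longleftrightarrow> (\<forall>x \<in> verts \<Delta>. out_degree \<Delta> x = in_degree \<Delta> x)"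
    using assms(3) by (auto simp: closed_euler)
  moreover have "circuit_eulerian \<Longrightarrow> dicircuit_strongly_connected"
    using assms(3) eulerian_dicircuit_imp_dicircuit_strongly_connected
    by (auto simp: circuit_eulerian_def)
  ultimately show ?thesis by blast
qed

end
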